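(* If $G$ is a finitely generated elementary amenable group, then $G$ is cascading.
   Context: The class of elementary amenable groups is the smallest class of groups containing all finite groups and all abelian groups that is closed under isomorphism, extensions and direct limits (directed unions). An HNN extension with vertex group $A$ and stable letter $t$ is a group with presentation $\langle A,t\mid t^{-1}ct=\iota(c)\ (c\in C)\rangle$, where $C\leqslant A$ is a subgroup and $\iota\colon C\to A$ is a monomorphism; its quotient by the normal closure of $A$ is infinite cyclic, generated by the image of $t$. Given an epimorphism $\phi\colon H\to\mathbb{Z}$, a splitting of $H$ as an HNN extension with vertex group $A$ realises $\phi$ if $\phi$ coincides with the quotient map dividing $H$ by the normal closure of $A$ (identified with $\mathbb{Z}$ via a generator given by the image of the stable letter or its inverse). For an ordinal $\alpha$, the class of $\alpha$-cascading groups is defined inductively: the $0$-cascading groups are the finite groups; for $\alpha>0$, a group $G$ is $\alpha$-cascading if it admits a finite-index subgroup $H$ and an epimorphism $H\to\mathbb{Z}$ such that for every splitting of $H$ as an HNN extension realising this epimorphism, if the vertex group is finitely generated, then it is $\beta$-cascading for some $\beta<\alpha$. A group is cascading if it is $\alpha$-cascading for some ordinal $\alpha$. *)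

theory Defs
  imports "HOL-Algebra.Elementary_Groups"
begin

unbundle cardinal_syntax

definition finitely_generated :: "('a, 'b) monoid_scheme \<Rightarrow> bool" where
  "finitely_generated G \<longleftrightarrow> (\<exists>S \<subseteq> carrier G. finite S \<and> generate G S = carrier G)"

definition normal_closure :: "('a, 'b) monoid_scheme \<Rightarrow> 'a set \<Rightarrow> 'a set" where
  "normal_closure G S = \<Inter>{N. N \<lhd> G \<and> S \<subseteq> N}"


section \<open>Elementary amenable groups\<close>

text \<open>The closure conditions only ever pass from \<open>G\<close> to subgroups, to isomorphic copies
  and to quotients of \<open>G\<close>. Each of these has a copy with carrier inside the type \<open>'a\<close> (for
  a quotient: coset representatives), so forming the closure inside one type loses nothing.
  In \<open>extension\<close> the short exact sequence is \<open>1 \<rightarrow> ker q \<rightarrow> G \<rightarrow> Q \<rightarrow> 1\<close>.\<close>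

inductive elementary_amenable :: "'a monoid \<Rightarrow> bool" where
  finite: "group G \<Longrightarrow> finite (carrier G) \<Longrightarrow> elementary_amenable G"
| abelian: "comm_group G \<Longrightarrow> elementary_amenable G"
| isomorphism: "elementary_amenable G \<Longrightarrow> group H \<Longrightarrow> G \<cong> H \<Longrightarrow> elementary_amenable H"
| extension: "group G \<Longrightarrow> q \<in> epi G Q \<Longrightarrow> elementary_amenable Q \<Longrightarrow>
    elementary_amenable (G\<lparr>carrier := kernel G Q q\<rparr>) \<Longrightarrow> elementary_amenable G"
| directed_union: "group G \<Longrightarrow> \<F> \<noteq> {} \<Longrightarrow>
    (\<And>H. H \<in> \<F> \<Longrightarrow> subgroup H G \<and> elementary_amenable (G\<lparr>carrier := H\<rparr>)) \<Longrightarrow>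
    (\<And>H K. H \<in> \<F> \<Longrightarrow> K \<in> \<F> \<Longrightarrow> \<exists>L \<in> \<F>. H \<subseteq> L \<and> K \<subseteq> L) \<Longrightarrow>
    \<Union>\<F> = carrier G \<Longrightarrow> elementary_amenable G"


section \<open>Group presentations\<close>

text \<open>A letter \<open>(x, True)\<close> stands for the generator \<open>x\<close> and \<open>(x, False)\<close> for its formal inverse.
  A relation \<open>u = v\<close> is a pair \<open>(u, v)\<close> of words.\<close>

type_synonym 'x word = "('x \<times> bool) list"

definition words :: "'x set \<Rightarrow> 'x word set" where
  "words X = lists (X \<times> UNIV)"

inductive_set pres_rel :: "'x set \<Rightarrow> ('x word \<times> 'x word) set \<Rightarrow> ('x word \<times> 'x word) set"
  for X R where
  refl: "u \<in> words X \<Longrightarrow> (u, u) \<in> pres_rel X R"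
| sym: "(u, v) \<in> pres_rel X R \<Longrightarrow> (v, u) \<in> pres_rel X R"
| trans: "(u, v) \<in> pres_rel X R \<Longrightarrow> (v, w) \<in> pres_rel X R \<Longrightarrow> (u, w) \<in> pres_rel X R"
| append: "(u, u') \<in> pres_rel X R \<Longrightarrow> (v, v') \<in> pres_rel X R \<Longrightarrow> (u @ v, u' @ v') \<in> pres_rel X R"
| cancel: "x \<in> X \<Longrightarrow> ([(x, b), (x, \<not> b)], []) \<in> pres_rel X R"
| relation: "(u, v) \<in> R \<Longrightarrow> u \<in> words X \<Longrightarrow> v \<in> words X \<Longrightarrow> (u, v) \<in> pres_rel X R"

definition pres_class :: "'x set \<Rightarrow> ('x word \<times> 'x word) set \<Rightarrow> 'x word \<Rightarrow> 'x word set" where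
  "pres_class X R w = pres_rel X R `` {w}"

definition presented_group :: "'x set \<Rightarrow> ('x word \<times> 'x word) set \<Rightarrow> 'x word set monoid" where
  "presented_group X R =
    \<lparr>carrier = words X // pres_rel X R,
     monoid.mult = (\<lambda>U V. \<Union>u\<in>U. \<Union>v\<in>V. pres_class X R (u @ v)),
     monoid.one = pres_class X R []\<rparr>"

lemma pres_rel_words: "(u,v) \<in> pres_rel X R \<Longrightarrow> u \<in> words X \<and> v \<in> words X"
  by (induction rule: pres_rel.induct) (auto simp: words_def)

lemma equiv_pres_rel: "equiv (words X) (pres_rel X R)"
  by (rule equivI) (auto simp: refl_on_def sym_def trans_def dest: pres_rel_words intro: pres_rel.intros)

lemma pres_class_eq: "(u,v) \<in> pres_rel X R \<Longrightarrow> pres_class X R u = pres_class X R v"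
  unfolding pres_class_def using equiv_pres_rel equiv_class_eq by metis

lemma mult_pres_class: assumes "u \<in> words X" "v \<in> words X"
  shows "pres_class X R u \<otimes>\<^bsub>presented_group X R\<^esub> pres_class X R v = pres_class X R (u @ v)"
proof -
  have "\<And>u' v'. (u,u') \<in> pres_rel X R \<Longrightarrow> (v,v') \<in> pres_rel X R \<Longrightarrow> pres_class X R (u' @ v') = pres_class X R (u @ v)"
    by (metis pres_class_eq pres_rel.append)
  then show ?thesis using assms
    by (auto simp: presented_group_def pres_class_def Image_def intro: pres_rel.refl)
qed

lemma carrier_presented_group: "carrier (presented_group X R) = pres_class X R ` words X"
  by (auto simp: presented_group_def quotient_def pres_class_def)

lemma words_append: "u \<in> words X \<Longrightarrow> v \<in> words X \<Longrightarrow> u @ v \<in> words X" by (auto simp: words_def)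

lemma pres_rel_left_inverse: "u \<in> words X \<Longrightarrow> \<exists>v\<in>words X. (v @ u, []) \<in> pres_rel X R"
proof (induction u)
  case Nil then show ?case by (auto simp: words_def intro!: bexI[of _ "[]"] pres_rel.refl)
next
  case (Cons a u)
  obtain x b where a: "a = (x,b)" by (cases a)
  have x: "x \<in> X" and u: "u \<in> words X" using Cons.prems a by (auto simp: words_def)
  obtain v where v: "v \<in> words X" "(v @ u, []) \<in> pres_rel X R" using Cons.IH u by auto
  let ?w = "v @ [(x, \<not> b)]"
  have "([(x, \<not> b),(x,b)],[]) \<in> pres_rel X R" using pres_rel.cancel[OF x, of "\<not> b"] by simp
  then have "([(x, \<not> b),(x,b)] @ u,[] @ u) \<in> pres_rel X R" using pres_rel.append pres_rel.refl[OF u] by metis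
  then have "(v @ ([(x, \<not> b),(x,b)] @ u),v @ ([] @ u)) \<in> pres_rel X R" using pres_rel.append pres_rel.refl[OF v(1)] by metis
  then have "(?w @ (a # u), []) \<in> pres_rel X R" using v(2) a by (auto intro: pres_rel.trans)
  moreover have "?w \<in> words X" using v x by (auto simp: words_def)
  ultimately show ?case by blast
qed

theorem presented_group_is_group: "group (presented_group X R)"
proof (rule groupI)
  have o: "\<one>\<^bsub>presented_group X R\<^esub> = pres_class X R []" by (simp add: presented_group_def)
  have n: "[] \<in> words X" by (simp add: words_def)
  show "\<one>\<^bsub>presented_group X R\<^esub> \<in> carrier (presented_group X R)" using o n carrier_presented_group by blast
  fix x assume x: "x \<in> carrier (presented_group X R)"
  then show "\<one>\<^bsub>presented_group X R\<^esub> \<otimes>\<^bsub>presented_group X R\<^esub> x = x" using o n by (auto simp: carrier_presented_group mult_pres_class)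
  show "\<exists>y\<in>carrier (presented_group X R). y \<otimes>\<^bsub>presented_group X R\<^esub> x = \<one>\<^bsub>presented_group X R\<^esub>"
    using x pres_rel_left_inverse[of _ X R] o by (auto simp: carrier_presented_group mult_pres_class) (metis pres_class_eq mult_pres_class)
qed (auto simp: carrier_presented_group mult_pres_class words_append)


section \<open>HNN extensions\<close>

datatype 'a hnn_gen = Vertex 'a | Stable

definition hnn_gens :: "('a, 'b) monoid_scheme \<Rightarrow> 'a hnn_gen set" where
  "hnn_gens A = insert Stable (Vertex ` carrier A)"

definition hnn_relations ::
  "('a, 'b) monoid_scheme \<Rightarrow> 'a set \<Rightarrow> ('a \<Rightarrow> 'a) \<Rightarrow> ('a hnn_gen word \<times> 'a hnn_gen word) set" where
  "hnn_relations A C \<iota> =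
     {([(Vertex a, True), (Vertex b, True)], [(Vertex (a \<otimes>\<^bsub>A\<^esub> b), True)]) | a b.
        a \<in> carrier A \<and> b \<in> carrier A} \<union>
     {([(Stable, False), (Vertex c, True), (Stable, True)], [(Vertex (\<iota> c), True)]) | c. c \<in> C}"

definition hnn_extension ::
  "('a, 'b) monoid_scheme \<Rightarrow> 'a set \<Rightarrow> ('a \<Rightarrow> 'a) \<Rightarrow> 'a hnn_gen word set monoid" where
  "hnn_extension A C \<iota> = presented_group (hnn_gens A) (hnn_relations A C \<iota>)"

definition hnn_class ::
  "('a, 'b) monoid_scheme \<Rightarrow> 'a set \<Rightarrow> ('a \<Rightarrow> 'a) \<Rightarrow> 'a hnn_gen \<Rightarrow> 'a hnn_gen word set" where
  "hnn_class A C \<iota> x = pres_class (hnn_gens A) (hnn_relations A C \<iota>) [(x, True)]"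

text \<open>A splitting of \<open>H\<close> as an HNN extension consists of a subgroup \<open>A\<close> of \<open>H\<close>, a subgroup
  \<open>C\<close> of \<open>A\<close>, a monomorphism \<open>\<iota>\<close> from \<open>C\<close> to \<open>A\<close> and an element \<open>t\<close> of \<open>H\<close> such that the
  inclusion of \<open>A\<close> and the stable letter going to \<open>t\<close> give an isomorphism from the HNN
  extension onto \<open>H\<close>. The vertex group always embeds in an HNN extension, so taking it to be
  a subgroup of \<open>H\<close> is no restriction.\<close>

definition hnn_splitting ::
  "'a monoid \<Rightarrow> 'a set \<Rightarrow> 'a set \<Rightarrow> ('a \<Rightarrow> 'a) \<Rightarrow> 'a \<Rightarrow> bool" where
  "hnn_splitting H A C \<iota> t \<longleftrightarrow>
     subgroup A H \<and> subgroup C (H\<lparr>carrier := A\<rparr>) \<and>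
     \<iota> \<in> mon (H\<lparr>carrier := C\<rparr>) (H\<lparr>carrier := A\<rparr>) \<and> t \<in> carrier H \<and>
     (\<exists>\<Phi> \<in> iso (hnn_extension (H\<lparr>carrier := A\<rparr>) C \<iota>) H.
        (\<forall>a \<in> A. \<Phi> (hnn_class (H\<lparr>carrier := A\<rparr>) C \<iota> (Vertex a)) = a) \<and>
        \<Phi> (hnn_class (H\<lparr>carrier := A\<rparr>) C \<iota> Stable) = t)"

definition realises :: "'a monoid \<Rightarrow> ('a \<Rightarrow> int) \<Rightarrow> 'a set \<Rightarrow> 'a \<Rightarrow> bool" where
  "realises H \<phi> A t \<longleftrightarrow>
     (\<exists>\<theta> \<in> iso (H Mod normal_closure H A) integer_group.
        \<theta> (normal_closure H A #>\<^bsub>H\<^esub> t) \<in> {1, -1} \<and>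
        (\<forall>h \<in> carrier H. \<phi> h = \<theta> (normal_closure H A #>\<^bsub>H\<^esub> h)))"


section \<open>Cascading groups\<close>

text \<open>Ordinals are represented by well-orders on a type \<open>'o\<close>, compared by \<open><o\<close>; the ordinal
  \<open>0\<close> is the empty relation. The recursive call occurs positively and on strictly smaller
  ordinals, so the inductive predicate is the one given by transfinite recursion.\<close>

inductive alpha_cascading :: "'o rel \<Rightarrow> 'a monoid \<Rightarrow> bool" where
  zero: "group G \<Longrightarrow> finite (carrier G) \<Longrightarrow> alpha_cascading {} G"
| pos: "Well_order \<alpha> \<Longrightarrow> \<alpha> \<noteq> {} \<Longrightarrow> group G \<Longrightarrow> subgroup H G \<Longrightarrow> finite (rcosets\<^bsub>G\<^esub> H) \<Longrightarrow>
    \<phi> \<in> epi (G\<lparr>carrier := H\<rparr>) integer_group \<Longrightarrow>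
    (\<And>A C \<iota> t. hnn_splitting (G\<lparr>carrier := H\<rparr>) A C \<iota> t \<Longrightarrow>
       realises (G\<lparr>carrier := H\<rparr>) \<phi> A t \<Longrightarrow> finitely_generated (G\<lparr>carrier := A\<rparr>) \<Longrightarrow>
       \<exists>\<beta>. \<beta> <o \<alpha> \<and> alpha_cascading \<beta> (G\<lparr>carrier := A\<rparr>)) \<Longrightarrow>
    alpha_cascading \<alpha> G"

text \<open>For groups with carrier in \<open>'a\<close> it is enough to use the ordinals that are order types
  of well-orders on \<open>'a monoid\<close>: by the theorem \<open>cascadingI\<close> at the end of this theory, no
  ordinal represented on any other type adds a cascading group.\<close>

definition cascading :: "'a monoid \<Rightarrow> bool" where
  "cascading G \<longleftrightarrow> (\<exists>\<alpha> :: 'a monoid rel. Well_order \<alpha> \<and> alpha_cascading \<alpha> G)"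

lemma alpha_cascading_Well_order: "alpha_cascading \<alpha> G \<Longrightarrow> Well_order \<alpha>"
  by (erule alpha_cascading.cases) auto

lemma not_less_empty: "\<not> (r :: 'x rel) <o ({} :: 'y rel)"
proof
  assume l: "r <o ({} :: 'y rel)"
  then have "Well_order r" by (auto simp: ordLess_def)
  then show False using l ordLess_iff_ordIso_Restr[of "{} :: 'y rel" r] by (auto simp: well_order_on_def ordLess_def)
qed

lemma empty_less: assumes "Well_order (r :: 'x rel)" "r \<noteq> {}" shows "({} :: 'y rel) <o r"
proof (rule ccontr)
  assume "\<not> ?thesis"
  moreover have "Well_order ({} :: 'y rel)" by simp
  ultimately have "r \<le>o ({} :: 'y rel)" using assms not_ordLess_iff_ordLeq by blast
  then obtain f where "embed r ({} :: 'y rel) f" by (auto simp: ordLeq_def)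
  then have "Field r = {}" using embed_Field by fastforce
  then show False using assms by (auto simp: Field_def)
qed

theorem cascadingI:
  fixes \<alpha> :: "'o rel" and G :: "'a monoid"
  assumes "alpha_cascading \<alpha> G"
  shows "cascading G"
proof -
  define S where "S = {K :: 'a monoid. \<exists>\<beta> :: 'o rel. alpha_cascading \<beta> K}"
  define m where "m = (\<lambda>K :: 'a monoid. SOME \<beta> :: 'o rel. alpha_cascading \<beta> K \<and>
    (\<forall>\<gamma> :: 'o rel. alpha_cascading \<gamma> K \<longrightarrow> \<beta> \<le>o \<gamma>))"
  have m: "alpha_cascading (m K) K \<and> (\<forall>\<gamma> :: 'o rel. alpha_cascading \<gamma> K \<longrightarrow> m K \<le>o \<gamma>)" if "K \<in> S" for K
  proof -
    have "\<exists>\<beta> \<in> {\<beta> :: 'o rel. alpha_cascading \<beta> K}. \<forall>\<gamma> \<in> {\<beta> :: 'o rel. alpha_cascading \<beta> K}. \<beta> \<le>o \<gamma>"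
      by (rule exists_minim_Well_order) (use that in \<open>auto simp: S_def dest: alpha_cascading_Well_order\<close>)
    then show ?thesis unfolding m_def by - (rule someI_ex, auto)
  qed
  have W: "Well_order (m K)" if "K \<in> S" for K using m[OF that] alpha_cascading_Well_order by blast
  define rep where "rep = (\<lambda>K. SOME L. L \<in> S \<and> m L =o m K)"
  have rep: "rep K \<in> S \<and> m (rep K) =o m K" if "K \<in> S" for K
    unfolding rep_def by (rule someI[of _ K]) (use that W in \<open>auto intro: ordIso_reflexive\<close>)
  have rep_eq: "rep K = rep L" if "K \<in> S" "L \<in> S" "m K =o m L" for K L
  proof -
    have "(N \<in> S \<and> m N =o m K) = (N \<in> S \<and> m N =o m L)" for N
      using that(3) by (meson ordIso_symmetric ordIso_transitive)
    then show ?thesis by (simp add: rep_def)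
  qed
  define T where "T = rep ` S"
  have TS: "T \<subseteq> S" using rep by (auto simp: T_def)
  have T_eq: "K = L" if KL: "K \<in> T" "L \<in> T" "m K =o m L" for K L
  proof -
    obtain K' L' where *: "K' \<in> S" "L' \<in> S" "K = rep K'" "L = rep L'" using KL(1,2) unfolding T_def by blast
    have "m K' =o m L'" using KL(3) rep[OF *(1)] rep[OF *(2)] *(3,4)
      by (meson ordIso_symmetric ordIso_transitive)
    then show ?thesis using rep_eq * by simp
  qed
  define s where "s = {(K, L). K \<in> T \<and> L \<in> T \<and> m K \<le>o m L}"
  have m_refl: "m K \<le>o m K" if "K \<in> T" for K using that TS W ordLeq_reflexive by blast
  have m_total: "m K \<le>o m L \<or> m L \<le>o m K" if "K \<in> T" "L \<in> T" for K L
    using that TS W ordLeq_total by blast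
  have Fs: "Field s = T"
    using m_refl by (auto simp: s_def Field_def)
  have Ws: "Well_order s"
    unfolding well_order_on_def linear_order_on_def partial_order_on_def preorder_on_def Fs
  proof (intro conjI)
    show "s \<subseteq> T \<times> T" by (auto simp: s_def)
    show "refl_on T s" using m_refl by (auto simp: s_def refl_on_def)
    show "trans s" by (auto simp: s_def trans_def intro: ordLeq_transitive)
    show "antisym s" by (auto simp: s_def antisym_def intro: T_eq simp: ordIso_iff_ordLeq)
    show "total_on T s" using m_total by (auto simp: s_def total_on_def)
    have "s - Id \<subseteq> inv_image ordLess m"
    proof (rule subrelI)
      fix K L assume "(K, L) \<in> s - Id"
      then show "(K, L) \<in> inv_image ordLess m"
        using T_eq[of K L] by (auto simp: s_def ordLeq_iff_ordLess_or_ordIso)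
    qed
    then show "wf (s - Id)" using wf_subset wf_inv_image wf_ordLess by blast
  qed
  define sr where "sr = (\<lambda>K. Restr s {L. m L <o m K})"
  have Wsr: "Well_order (sr K)" for K unfolding sr_def by (rule Well_order_Restr[OF Ws])
  have sr_less: "rep A \<in> Field (sr K) \<and> sr A <o sr K" if AK: "A \<in> S" "K \<in> S" "m A <o m K" for A K
  proof -
    let ?L = "rep A"
    have L: "?L \<in> T" "m ?L =o m A" using rep AK by (auto simp: T_def)
    have LK: "m ?L <o m K" using L AK ordIso_ordLess_trans by blast
    have refl: "m ?L \<le>o m ?L" using L TS W ordLeq_reflexive by blast
    have LF: "?L \<in> Field (sr K)" using L LK refl by (auto simp: sr_def s_def Field_def)
    have eq: "N \<in> underS (sr K) ?L \<longleftrightarrow> m N <o m A" if N: "N \<in> T" for N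
    proof
      assume "N \<in> underS (sr K) ?L"
      then have "N \<noteq> ?L" "m N \<le>o m ?L" by (auto simp: underS_def sr_def s_def)
      then have "m N <o m ?L" using T_eq[OF N L(1)] by (auto simp: ordLeq_iff_ordLess_or_ordIso)
      then show "m N <o m A" using L(2) ordLess_ordIso_trans by blast
    next
      assume a: "m N <o m A"
      then have b: "m N <o m ?L" using L(2) ordIso_symmetric ordLess_ordIso_trans by blast
      then have "N \<noteq> ?L" using ordLess_irreflexive by metis
      moreover have "m N <o m K" using a AK ordLess_transitive by blast
      ultimately show "N \<in> underS (sr K) ?L" using b N L LK
        by (auto simp: underS_def sr_def s_def ordLess_imp_ordLeq)
    qed
    have "sr A = Restr (sr K) (underS (sr K) ?L)"
    proof (intro equalityI subsetI)
      fix p assume "p \<in> sr A"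
      then obtain M N where p: "p = (M, N)" "(M,N) \<in> s" "m M <o m A" "m N <o m A" by (auto simp: sr_def)
      then have "M \<in> T" "N \<in> T" by (auto simp: s_def)
      moreover have "m M <o m K" "m N <o m K" using p AK ordLess_transitive by blast+
      ultimately show "p \<in> Restr (sr K) (underS (sr K) ?L)" using eq p by (auto simp: sr_def)
    next
      fix p assume "p \<in> Restr (sr K) (underS (sr K) ?L)"
      then obtain M N where p: "p = (M, N)" "(M,N) \<in> sr K" "M \<in> underS (sr K) ?L" "N \<in> underS (sr K) ?L"
        by auto
      then have "(M, N) \<in> s" "M \<in> T" "N \<in> T" by (auto simp: sr_def s_def)
      then show "p \<in> sr A" using eq p by (auto simp: sr_def)
    qed
    then show ?thesis using LF underS_Restr_ordLess[OF Wsr[of K]] by auto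
  qed
  have main: "alpha_cascading (sr K) K" if "K \<in> S" for K
    using wf_inv_image[OF wf_ordLess, of m] that
  proof (induction K rule: wf_induct_rule)
    case (less K)
    have "alpha_cascading (m K) K" using m less.prems by blast
    then show ?case
    proof cases
      case zero
      then have "sr K = {}" by (auto simp: sr_def not_less_empty)
      then show ?thesis using zero alpha_cascading.zero by metis
    next
      case (pos H \<phi>)
      define E where "E = K\<lparr>carrier := {\<one>\<^bsub>K\<^esub>}\<rparr>"
      have "group E" unfolding E_def using pos group.triv_subgroup subgroup.subgroup_is_group by blast
      then have E: "alpha_cascading ({} :: 'o rel) E" by (intro alpha_cascading.zero) (auto simp: E_def)
      then have ES: "E \<in> S" by (auto simp: S_def)
      have "m E \<le>o ({} :: 'o rel)" using m[OF ES] E by blast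
      moreover have "({} :: 'o rel) <o m K" using W[OF less.prems] pos(2)
        using empty_less by blast
      ultimately have "sr K \<noteq> {}" using sr_less[OF ES less.prems] ordLeq_ordLess_trans by fastforce
      then show ?thesis
      proof (rule alpha_cascading.pos[OF Wsr _ pos(3-6)])
        fix A C \<iota> t assume "hnn_splitting (K\<lparr>carrier := H\<rparr>) A C \<iota> t"
          "realises (K\<lparr>carrier := H\<rparr>) \<phi> A t" "finitely_generated (K\<lparr>carrier := A\<rparr>)"
        then obtain \<beta> :: "'o rel" where \<beta>: "\<beta> <o m K" "alpha_cascading \<beta> (K\<lparr>carrier := A\<rparr>)" using pos(7) by blast
        let ?A = "K\<lparr>carrier := A\<rparr>"
        have AS: "?A \<in> S" using \<beta> by (auto simp: S_def)
        have "m ?A <o m K" using m[OF AS] \<beta> ordLeq_ordLess_trans by blast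
        then show "\<exists>\<beta> :: 'a monoid rel. \<beta> <o sr K \<and> alpha_cascading \<beta> ?A"
          using sr_less[OF AS less.prems] less.IH[of ?A] AS by auto
      qed
    qed
  qed
  have "G \<in> S" using assms by (auto simp: S_def)
  then show ?thesis using main Wsr unfolding cascading_def by blast
qed

end

theory Submission
  imports Defs "HOL-Algebra.Multiplicative_Group"
begin

text \<open>A vertex group of a splitting realising \<open>\<phi>\<close> lies in \<open>ker \<phi>\<close>. Hence it is enough that
  the finitely generated subgroups of a suitable \<open>ker \<phi>\<close> are again cascading, and the theory of
  HNN extensions is not needed. Call a group locally good if all its finitely generated subgroups
  satisfy this recursive condition. If \<open>N\<close> and \<open>G/N\<close> are locally good, then so is \<open>G\<close>: along the
  cascade of the image in \<open>G/N\<close>, pull back the epimorphisms to \<open>\<int>\<close>; where the image is finite,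
  the intersection with \<open>N\<close> is finitely generated by Schreier's lemma and its cascade can be
  used. Finitely generated abelian groups are iterated extensions of cyclic ones, and directed
  unions are trivial because the condition is local.\<close>

section \<open>Finitely generated subgroups\<close>

lemma (in group) finitely_generated_subgroup_iff:
  assumes "subgroup A G"
  shows "finitely_generated (G\<lparr>carrier := A\<rparr>) \<longleftrightarrow> (\<exists>S \<subseteq> A. finite S \<and> generate G S = A)"
  unfolding finitely_generated_def using generate_consistent[OF _ assms] by auto

lemma (in group_hom) finitely_generated_image:
  assumes "subgroup A G" and "finitely_generated (G\<lparr>carrier := A\<rparr>)"
  shows "finitely_generated (H\<lparr>carrier := h ` A\<rparr>)"
proof -
  obtain S where S: "S \<subseteq> A" "finite S" "generate G S = A"
    using G.finitely_generated_subgroup_iff[OF assms(1)] assms(2) by blast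
  have "S \<subseteq> carrier G" using S(1) subgroup.subset[OF assms(1)] by blast
  then have "generate H (h ` S) = h ` A" using generate_img S(3) by metis
  moreover have "h ` S \<subseteq> h ` A" and "finite (h ` S)" using S(1,2) by auto
  ultimately show ?thesis
    unfolding H.finitely_generated_subgroup_iff[OF subgroup_img_is_subgroup[OF assms(1)]]
    by (intro exI conjI)
qed

text \<open>Schreier's lemma, for a finite-index normal subgroup given as a kernel: with \<open>r\<close> a section
  of \<open>q\<close> satisfying \<open>r 1 = 1\<close>, the elements \<open>r(y) s r(y q(s))\<^sup>-\<^sup>1\<close> generate the kernel.\<close>

lemma (in group_hom) finitely_generated_kernel:
  assumes "finitely_generated G" and "finite (carrier H)" and surj: "h ` carrier G = carrier H"
  shows "finitely_generated (G\<lparr>carrier := kernel G H h\<rparr>)"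
proof -
  obtain S where S: "S \<subseteq> carrier G" "finite S" "generate G S = carrier G"
    using assms(1) by (auto simp: finitely_generated_def)
  define r where "r y = (if y = \<one>\<^bsub>H\<^esub> then \<one> else (SOME g. g \<in> carrier G \<and> h g = y))" for y
  have r: "r y \<in> carrier G \<and> h (r y) = y" if "y \<in> carrier H" for y
  proof (cases "y = \<one>\<^bsub>H\<^esub>")
    case False
    have "\<exists>g. g \<in> carrier G \<and> h g = y" using that surj by (metis imageE)
    then show ?thesis using someI_ex[of "\<lambda>g. g \<in> carrier G \<and> h g = y"] False by (simp add: r_def)
  qed (simp add: r_def)
  define e where "e y g = r y \<otimes> g \<otimes> inv (r (y \<otimes>\<^bsub>H\<^esub> h g))" for y g
  have e_ker: "e y g \<in> kernel G H h" if "y \<in> carrier H" "g \<in> carrier G" for y g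
    using that r[of y] r[of "y \<otimes>\<^bsub>H\<^esub> h g"] by (simp add: e_def kernel_def)
  define U where "U = (\<lambda>(y, s). e y s) ` (carrier H \<times> S)"
  have U_ker: "U \<subseteq> kernel G H h" using e_ker S(1) by (auto simp: U_def)
  have U_carrier: "U \<subseteq> carrier G" using U_ker by (auto simp: kernel_def)
  \<comment> \<open>The inner factors \<open>r (y h(g1))\<close> cancel. So \<open>e\<close> of a
    word splits into values of \<open>e\<close> on its letters, while the first argument moves
    through \<open>H\<close> along the images of the prefixes.\<close>
  have e_mult: "e y (g1 \<otimes> g2) = e y g1 \<otimes> e (y \<otimes>\<^bsub>H\<^esub> h g1) g2"
    if "y \<in> carrier H" "g1 \<in> carrier G" "g2 \<in> carrier G" for y g1 g2
    using that r[of y] r[of "y \<otimes>\<^bsub>H\<^esub> h g1"] r[of "y \<otimes>\<^bsub>H\<^esub> h g1 \<otimes>\<^bsub>H\<^esub> h g2"]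
    by (simp add: e_def G.m_assoc H.m_assoc G.inv_solve_left' flip: G.m_assoc[of "inv (r (y \<otimes>\<^bsub>H\<^esub> h g1))"])
  have e_inv: "e y (inv g) = inv (e (y \<otimes>\<^bsub>H\<^esub> inv\<^bsub>H\<^esub> (h g)) g)"
    if "y \<in> carrier H" "g \<in> carrier G" for y g
    using that r[of y] r[of "y \<otimes>\<^bsub>H\<^esub> inv\<^bsub>H\<^esub> (h g)"]
    by (simp add: e_def G.m_assoc H.m_assoc G.inv_mult_group)
  \<comment> \<open>The quantifier over \<open>y\<close> stays inside the induction because
    \<open>e_mult\<close> and \<open>e_inv\<close> change the first argument.\<close>
  have e_gen: "\<forall>y \<in> carrier H. e y g \<in> generate G U" if "g \<in> generate G S" for g
    using that
  proof induction
    case one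
    show ?case using r by (auto simp: e_def generate.one)
  next
    case (incl g)
    then show ?case by (auto simp: U_def intro!: generate.incl)
  next
    case (inv g)
    have "e (y \<otimes>\<^bsub>H\<^esub> inv\<^bsub>H\<^esub> (h g)) g \<in> U" if "y \<in> carrier H" for y
      unfolding U_def by (rule image_eqI[of _ _ "(y \<otimes>\<^bsub>H\<^esub> inv\<^bsub>H\<^esub> (h g), g)"]) (use that inv S(1) in auto)
    moreover have "g \<in> carrier G" using inv S(1) by blast
    ultimately show ?case using e_inv by (simp add: generate.inv)
  next
    case (eng g1 g2)
    have "g1 \<in> carrier G" "g2 \<in> carrier G" using eng(1,2) S(3) by auto
    then show ?case using eng e_mult by (auto intro!: generate.eng)
  qed
  have "generate G U = kernel G H h"
  proof
    show "generate G U \<subseteq> kernel G H h"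
      using G.generate_subgroup_incl[OF U_ker subgroup_kernel] .
    show "kernel G H h \<subseteq> generate G U"
    proof
      fix k assume k: "k \<in> kernel G H h"
      then have kG: "k \<in> carrier G" "h k = \<one>\<^bsub>H\<^esub>" by (auto simp: kernel_def)
      \<comment> \<open>Here the choice \<open>r 1 = 1\<close> matters: both section factors vanish,
        since \<open>h k = 1\<close>.\<close>
      then have "e \<one>\<^bsub>H\<^esub> k = k" by (simp add: e_def r_def)
      then show "k \<in> generate G U" using e_gen kG(1) S(3) by (metis H.one_closed)
    qed
  qed
  moreover have "finite U" using S(2) assms(2) by (simp add: U_def)
  ultimately show ?thesis
    unfolding G.finitely_generated_subgroup_iff[OF subgroup_kernel] using U_ker by blast
qed


section \<open>Cascades without ordinals\<close>

text \<open>This strengthens the cascading condition: the vertex group of any splitting realising \<open>\<phi>\<close>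
  lies in the kernel of \<open>\<phi>\<close>, and here every finitely generated subgroup of that kernel is
  required to satisfy the condition again.\<close>

inductive kernel_cascading :: "'a monoid \<Rightarrow> bool" where
  finite: "group G \<Longrightarrow> finite (carrier G) \<Longrightarrow> kernel_cascading G"
| step: "group G \<Longrightarrow> subgroup H G \<Longrightarrow> finite (rcosets\<^bsub>G\<^esub> H) \<Longrightarrow>
    \<phi> \<in> epi (G\<lparr>carrier := H\<rparr>) integer_group \<Longrightarrow>
    (\<And>A. subgroup A G \<Longrightarrow> A \<subseteq> kernel (G\<lparr>carrier := H\<rparr>) integer_group \<phi> \<Longrightarrow>
       finitely_generated (G\<lparr>carrier := A\<rparr>) \<Longrightarrow> kernel_cascading (G\<lparr>carrier := A\<rparr>)) \<Longrightarrow>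
    kernel_cascading G"

text \<open>An ordinal below \<beta> is isomorphic to a proper initial segment of \<gamma>, so the
  cascade can be rebuilt on \<gamma> by recursion. The two relations may live on different types;
  this is what moves a cascade into a larger well-order.\<close>

lemma alpha_cascading_ordIso:
  fixes \<beta> :: "'p rel" and \<gamma> :: "'o rel"
  assumes "alpha_cascading \<beta> G" and "\<beta> =o \<gamma>"
  shows "alpha_cascading \<gamma> G"
  using assms
proof (induction arbitrary: \<gamma> rule: alpha_cascading.induct)
  case (zero G)
  have "\<gamma> = {}"
  proof (rule ccontr)
    assume "\<gamma> \<noteq> {}"
    moreover have "Well_order \<gamma>" using zero(3) by (auto simp: ordIso_def)
    ultimately have "({} :: 'p rel) <o \<gamma>" using empty_less by blast
    then show False using zero(3) not_ordLess_ordIso by blast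
  qed
  then show ?case using zero alpha_cascading.zero by blast
next
  case (pos \<alpha> G H \<phi>)
  have W: "Well_order \<gamma>" using pos.prems by (auto simp: ordIso_def)
  have "({} :: 'o rel) <o \<alpha>" using pos(1,2) empty_less by blast
  then have "({} :: 'o rel) <o \<gamma>" using pos.prems ordLess_ordIso_trans by blast
  then have "\<gamma> \<noteq> {}" using not_less_empty by blast
  then show ?case
  proof (rule alpha_cascading.pos[OF W _ pos(3-6)])
    fix A C \<iota> t
    assume "hnn_splitting (G\<lparr>carrier := H\<rparr>) A C \<iota> t" "realises (G\<lparr>carrier := H\<rparr>) \<phi> A t"
      "finitely_generated (G\<lparr>carrier := A\<rparr>)"
    from pos(7)[OF this] obtain \<beta> :: "'p rel" where \<beta>: "\<beta> <o \<alpha>"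
      "\<forall>\<gamma> :: 'o rel. \<beta> =o \<gamma> \<longrightarrow> alpha_cascading \<gamma> (G\<lparr>carrier := A\<rparr>)"
      by blast
    have "\<beta> <o \<gamma>" using \<beta>(1) pos.prems ordLess_ordIso_trans by blast
    then obtain a where a: "a \<in> Field \<gamma>" "\<beta> =o Restr \<gamma> (underS \<gamma> a)"
      using W \<beta>(1) ordLess_iff_ordIso_Restr[of \<gamma> \<beta>] by (auto simp: ordLess_def)
    show "\<exists>\<beta> :: 'o rel. \<beta> <o \<gamma> \<and> alpha_cascading \<beta> (G\<lparr>carrier := A\<rparr>)"
    proof (intro exI conjI)
      have "Field \<gamma> \<noteq> {}" using a(1) by blast
      then show "Restr \<gamma> (underS \<gamma> a) <o \<gamma>" by (rule underS_Restr_ordLess[OF W])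
      show "alpha_cascading (Restr \<gamma> (underS \<gamma> a)) (G\<lparr>carrier := A\<rparr>)" using \<beta>(2) a(2) by blast
    qed
  qed
qed

text \<open>By Cantor: otherwise the power set of the type would inject into the type itself. This
  supplies one ordinal strictly above all well-orders on \<open>'p\<close>.\<close>

lemma ordLess_card_of_Pow:
  fixes \<beta> :: "'p rel"
  assumes "Well_order \<beta>"
  shows "\<beta> <o |UNIV :: 'p set set|"
proof (rule ccontr)
  assume "\<not> ?thesis"
  then have "|UNIV :: 'p set set| \<le>o \<beta>"
    using assms card_of_Well_order not_ordLess_iff_ordLeq by blast
  then have "|UNIV :: 'p set set| \<le>o |Field \<beta>|"
    using card_of_mono2[of "|UNIV :: 'p set set|" \<beta>] by (simp add: Field_card_of)
  then obtain f :: "'p set \<Rightarrow> 'p" where "inj f"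
    using card_of_ordLeq[of "UNIV :: 'p set set" "Field \<beta>"] by auto
  then show False using Cantors_theorem by (metis inj_imp_surj_inv Pow_UNIV)
qed

text \<open>By realisation, \<phi> factors through the cosets of the normal closure of
  \<open>A\<close>, and each element of \<open>A\<close> has the same coset there as the
  identity.\<close>

lemma realises_vertex_group_subset_kernel:
  assumes "group H" and "\<phi> \<in> hom H integer_group" and "realises H \<phi> A t" and "A \<subseteq> carrier H"
  shows "A \<subseteq> kernel H integer_group \<phi>"
proof
  interpret group H by fact
  have one: "\<phi> \<one>\<^bsub>H\<^esub> = 0" using hom_one[OF assms(2)] assms(1) by simp
  fix a assume a: "a \<in> A"
  then have aH: "a \<in> carrier H" using assms(4) by blast
  let ?N = "normal_closure H A"
  have sub: "subgroup ?N H" unfolding normal_closure_def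
  proof (rule subgroups_Inter, goal_cases)
    case 2
    \<comment> \<open>The intersection defining the normal closure is a subgroup only if the family
      is nonempty; the whole group is a member.\<close>
    have "carrier H \<lhd> H" using subgroup_self by (auto intro!: normal_invI)
    then show "{N. N \<lhd> H \<and> A \<subseteq> N} \<noteq> {}" using assms(4) by blast
  qed (auto intro: normal_imp_subgroup)
  have "a \<in> ?N" using a by (auto simp: normal_closure_def)
  then have "?N #>\<^bsub>H\<^esub> a = ?N #>\<^bsub>H\<^esub> \<one>\<^bsub>H\<^esub>"
    using sub coset_join2[OF aH] coset_join2[OF one_closed] subgroup.one_closed by metis
  moreover obtain \<theta> where "\<And>h. h \<in> carrier H \<Longrightarrow> \<phi> h = \<theta> (?N #>\<^bsub>H\<^esub> h)"
    using assms(3) unfolding realises_def by blast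
  ultimately have "\<phi> a = \<phi> \<one>\<^bsub>H\<^esub>" using aH by simp
  then show "a \<in> kernel H integer_group \<phi>" using aH one by (simp add: kernel_def)
qed

text \<open>The ordinals of the vertex groups come with no common bound, but all of them are
  well-orders on \<open>'a monoid\<close>. The cardinal of the power set of that type exceeds them
  all and serves as \<alpha>; \<open>cascadingI\<close> then returns to the type demanded by
  \<open>cascading\<close>.\<close>

lemma kernel_cascading_imp_cascading: "kernel_cascading G \<Longrightarrow> cascading G"
proof (induction rule: kernel_cascading.induct)
  case (finite G)
  then show ?case using cascadingI alpha_cascading.zero by blast
next
  case (step G H \<phi>)
  interpret group G by fact
  let ?H = "G\<lparr>carrier := H\<rparr>"
  have gH: "group ?H" using step(2) subgroup.subgroup_is_group group_axioms by blast
  let ?\<alpha> = "|UNIV :: 'a monoid set set|"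
  have ne: "?\<alpha> \<noteq> {}" using Field_card_of[of "UNIV :: 'a monoid set set"]
    by (metis Field_empty UNIV_not_empty)
  have "alpha_cascading ?\<alpha> G"
  proof (rule alpha_cascading.pos[OF card_of_Well_order ne step(1-4)])
    fix A C \<iota> t
    assume A: "hnn_splitting ?H A C \<iota> t" "realises ?H \<phi> A t" "finitely_generated (G\<lparr>carrier := A\<rparr>)"
    have AH: "subgroup A ?H" using A(1) by (simp add: hnn_splitting_def)
    have "A \<subseteq> kernel ?H integer_group \<phi>"
      using realises_vertex_group_subset_kernel[OF gH _ A(2)] step(4) subgroup.subset[OF AH]
      by (simp add: epi_def)
    then have "cascading (G\<lparr>carrier := A\<rparr>)"
      using step.IH[OF incl_subgroup[OF step(2) AH] _ A(3)] by blast
    then obtain \<beta> :: "'a monoid rel" where \<beta>: "Well_order \<beta>" "alpha_cascading \<beta> (G\<lparr>carrier := A\<rparr>)"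
      unfolding cascading_def by (elim exE conjE)
    obtain a where a: "a \<in> Field ?\<alpha>" "\<beta> =o Restr ?\<alpha> (underS ?\<alpha> a)"
      using iffD1[OF ordLess_iff_ordIso_Restr[OF card_of_Well_order \<beta>(1)] ordLess_card_of_Pow[OF \<beta>(1)]]
      by (elim bexE)
    have "Field ?\<alpha> \<noteq> {}" using a(1) by (metis empty_iff)
    then have "Restr ?\<alpha> (underS ?\<alpha> a) <o ?\<alpha>"
      by (rule underS_Restr_ordLess[OF card_of_Well_order])
    then show "\<exists>\<beta> :: 'a monoid set rel. \<beta> <o ?\<alpha> \<and> alpha_cascading \<beta> (G\<lparr>carrier := A\<rparr>)"
      using alpha_cascading_ordIso[OF \<beta>(2) a(2)] by (intro exI conjI)
  qed
  then show ?case by (rule cascadingI)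
qed


section \<open>Extensions\<close>

text \<open>If the kernel is finite, so is \<open>G\<close>. Otherwise the subgroup \<open>H\<close>
  of the kernel and its epimorphism serve unchanged for \<open>G\<close>, because \<open>H\<close>
  still has finite index there.\<close>

lemma kernel_cascading_finite_extension:
  assumes "group_hom G Q q" and "finite (carrier Q)"
    and "kernel_cascading (G\<lparr>carrier := kernel G Q q\<rparr>)"
  shows "kernel_cascading G"
proof -
  interpret group_hom G Q q by fact
  let ?N = "kernel G Q q"
  define r where "r y = (SOME g. g \<in> carrier G \<and> q g = y)" for y
  have r: "r (q g) \<in> carrier G \<and> q (r (q g)) = q g" if "g \<in> carrier G" for g
    unfolding r_def by (rule someI[of _ g]) (use that in simp)
  have decomp: "g \<otimes>\<^bsub>G\<^esub> inv\<^bsub>G\<^esub> (r (q g)) \<in> ?N" "g = g \<otimes>\<^bsub>G\<^esub> inv\<^bsub>G\<^esub> (r (q g)) \<otimes>\<^bsub>G\<^esub> r (q g)" if "g \<in> carrier G" for g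
    using that r[OF that] by (auto simp: kernel_def G.m_assoc)
  have fin: "finite (q ` carrier G)" using assms(2) by (rule finite_subset[rotated]) auto
  from assms(3) show ?thesis
  proof cases
    case finite
    have "carrier G \<subseteq> (\<lambda>(n, y). n \<otimes>\<^bsub>G\<^esub> r y) ` (?N \<times> q ` carrier G)"
    proof
      fix g assume g: "g \<in> carrier G"
      then show "g \<in> (\<lambda>(n, y). n \<otimes>\<^bsub>G\<^esub> r y) ` (?N \<times> q ` carrier G)"
        by (intro image_eqI[of _ _ "(g \<otimes>\<^bsub>G\<^esub> inv\<^bsub>G\<^esub> (r (q g)), q g)"]) (use decomp in auto)
    qed
    then have "finite (carrier G)" using finite fin by (auto intro: finite_subset)
    then show ?thesis using kernel_cascading.finite G.is_group by blast
  next
    case (step H \<phi>)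
    have H: "subgroup H G" using G.incl_subgroup[OF subgroup_kernel step(2)] .
    have HN: "H \<subseteq> ?N" using subgroup.subset[OF step(2)] by simp
    let ?R = "rcosets\<^bsub>G\<lparr>carrier := ?N\<rparr>\<^esub> H"
    \<comment> \<open>Each coset of \<open>H\<close> in \<open>G\<close> is a coset of
      \<open>H\<close> in the kernel, translated by one of the finitely many representatives
      \<open>r y\<close>.\<close>
    have "rcosets\<^bsub>G\<^esub> H \<subseteq> (\<lambda>(C, y). C #>\<^bsub>G\<^esub> r y) ` (?R \<times> q ` carrier G)"
    proof
      fix C assume "C \<in> rcosets\<^bsub>G\<^esub> H"
      then obtain g where g: "g \<in> carrier G" "C = H #>\<^bsub>G\<^esub> g" by (auto simp: RCOSETS_def)
      let ?n = "g \<otimes>\<^bsub>G\<^esub> inv\<^bsub>G\<^esub> (r (q g))"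
      have "C = (H #>\<^bsub>G\<^esub> ?n) #>\<^bsub>G\<^esub> r (q g)"
        using g decomp[OF g(1)] r[OF g(1)] G.coset_mult_assoc[OF subgroup.subset[OF H], of ?n "r (q g)"]
        by (simp add: kernel_def)
      moreover have "H #>\<^bsub>G\<^esub> ?n \<in> ?R" using decomp[OF g(1)] by (auto simp: RCOSETS_def r_coset_def)
      ultimately show "C \<in> (\<lambda>(C, y). C #>\<^bsub>G\<^esub> r y) ` (?R \<times> q ` carrier G)" using g(1) by auto
    qed
    then have "finite (rcosets\<^bsub>G\<^esub> H)" using step(3) fin by (auto intro: finite_subset)
    then show ?thesis
    proof (rule kernel_cascading.step[OF G.is_group H])
      show "\<phi> \<in> epi (G\<lparr>carrier := H\<rparr>) integer_group" using step(4) by simp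
      fix A assume A: "subgroup A G" "A \<subseteq> kernel (G\<lparr>carrier := H\<rparr>) integer_group \<phi>"
        "finitely_generated (G\<lparr>carrier := A\<rparr>)"
      then have "A \<subseteq> ?N" using HN by (auto simp: kernel_def)
      then have "subgroup A (G\<lparr>carrier := ?N\<rparr>)" using G.subgroup_incl[OF A(1) subgroup_kernel] by blast
      then show "kernel_cascading (G\<lparr>carrier := A\<rparr>)" using step(5) A by simp
    qed
  qed
qed

text \<open>This is "locally good", relative to a subset \<open>N\<close>, so that kernels, images
  and generated subgroups can be treated without changing the ambient group.\<close>

definition locally_kernel_cascading :: "'a monoid \<Rightarrow> 'a set \<Rightarrow> bool" where
  "locally_kernel_cascading G N \<longleftrightarrow>
     (\<forall>A. subgroup A G \<longrightarrow> A \<subseteq> N \<longrightarrow> finitely_generated (G\<lparr>carrier := A\<rparr>) \<longrightarrow>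
        kernel_cascading (G\<lparr>carrier := A\<rparr>))"

text \<open>The coset of the preimage through \<open>g\<close> is the preimage of the coset of
  \<open>K\<close> through \<open>h g\<close>.\<close>

lemma (in group_hom) finite_rcosets_vimage:
  assumes K: "subgroup K H" and fin: "finite (rcosets\<^bsub>H\<^esub> K)"
  shows "finite (rcosets\<^bsub>G\<^esub> {g \<in> carrier G. h g \<in> K})" (is "finite (rcosets\<^bsub>G\<^esub> ?L)")
proof -
  have "rcosets\<^bsub>G\<^esub> ?L \<subseteq> (\<lambda>C. {g \<in> carrier G. h g \<in> C}) ` (rcosets\<^bsub>H\<^esub> K)"
  proof
    fix C assume "C \<in> rcosets\<^bsub>G\<^esub> ?L"
    then obtain g where g: "g \<in> carrier G" "C = ?L #> g" by (auto simp: RCOSETS_def)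
    have "C = {x \<in> carrier G. h x \<in> K #>\<^bsub>H\<^esub> h g}"
    proof
      show "C \<subseteq> {x \<in> carrier G. h x \<in> K #>\<^bsub>H\<^esub> h g}" using g by (auto simp: r_coset_def)
      show "{x \<in> carrier G. h x \<in> K #>\<^bsub>H\<^esub> h g} \<subseteq> C"
      proof
        fix x assume "x \<in> {x \<in> carrier G. h x \<in> K #>\<^bsub>H\<^esub> h g}"
        then obtain k where x: "x \<in> carrier G" "k \<in> K" "h x = k \<otimes>\<^bsub>H\<^esub> h g" by (auto simp: r_coset_def)
        have kH: "k \<in> carrier H" using x(2) subgroup.subset[OF K] by blast
        have "h (x \<otimes> inv g) = k" using x g kH by (simp add: H.m_assoc)
        then have "x \<otimes> inv g \<in> ?L" using x g by simp
        moreover have "x = x \<otimes> inv g \<otimes> g" using x g by (simp add: G.m_assoc)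
        ultimately show "x \<in> C" unfolding g(2) r_coset_def by blast
      qed
    qed
    then show "C \<in> (\<lambda>C. {g \<in> carrier G. h g \<in> C}) ` (rcosets\<^bsub>H\<^esub> K)"
      unfolding RCOSETS_def using g(1) hom_closed by blast
  qed
  then show ?thesis using fin by (auto intro: finite_subset)
qed

lemma group_hom_restrict:
  assumes "group_hom G H h" and "subgroup A G" and "subgroup B H" and "h ` A \<subseteq> B"
  shows "group_hom (G\<lparr>carrier := A\<rparr>) (H\<lparr>carrier := B\<rparr>) h"
proof -
  interpret group_hom G H h by fact
  have "h \<in> hom (G\<lparr>carrier := A\<rparr>) (H\<lparr>carrier := B\<rparr>)"
    using assms(4) subgroup.subset[OF assms(2)] by (auto simp: hom_def subset_iff)
  then show ?thesis
    using subgroup.subgroup_is_group[OF assms(2) G.is_group] subgroup.subgroup_is_group[OF assms(3) H.is_group]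
    by (simp add: group_hom_def group_hom_axioms_def)
qed

text \<open>Induction along the cascade of \<open>Q\<close>. For finite \<open>Q\<close>, the kernel
  is finitely generated, hence kernel cascading, and has finite index. Otherwise \<open>H\<close>
  and \<phi> are pulled back along \<open>q\<close>; a finitely generated \<open>A\<close> in the
  kernel of the pullback maps onto a finitely generated subgroup of the kernel of \<phi>, and the
  induction hypothesis applies to \<open>A\<close> over its image. Hence \<open>G\<close> and
  \<open>q\<close> must be arbitrary.\<close>

lemma kernel_cascading_extension:
  fixes G :: "'a monoid" and Q :: "'b monoid"
  assumes "kernel_cascading Q" and "group_hom G Q q" and "q ` carrier G = carrier Q"
    and "finitely_generated G" and "locally_kernel_cascading G (kernel G Q q)"
  shows "kernel_cascading G"
  using assms
proof (induction arbitrary: G q rule: kernel_cascading.induct)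
  case (finite Q)
  interpret group_hom G Q q by fact
  have "kernel_cascading (G\<lparr>carrier := kernel G Q q\<rparr>)"
    using finite finitely_generated_kernel subgroup_kernel
    unfolding locally_kernel_cascading_def by blast
  then show ?case using kernel_cascading_finite_extension finite by blast
next
  case (step Q H \<phi>)
  interpret group_hom G Q q by fact
  let ?L = "{g \<in> carrier G. q g \<in> H}"
  note H = step(2)
  have L: "subgroup ?L G"
    by (rule G.subgroupI)
      (use subgroup.one_closed[OF H] subgroup.m_closed[OF H] subgroup.m_inv_closed[OF H] in
       \<open>auto intro: exI[of _ "\<one>\<^bsub>G\<^esub>"]\<close>)
  have qL: "q ` ?L = H" using step.prems(2) subgroup.subset[OF H] by auto
  show ?case
  proof (rule kernel_cascading.step[OF G.is_group L finite_rcosets_vimage[OF H step(3)]])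
    show "\<phi> \<circ> q \<in> epi (G\<lparr>carrier := ?L\<rparr>) integer_group"
    proof -
      have "(\<phi> \<circ> q) ` ?L = UNIV" unfolding image_comp[symmetric] qL using step(4) by (simp add: epi_def)
      then show ?thesis using step(4) by (auto simp: epi_def hom_def)
    qed
    fix A assume A: "subgroup A G" "A \<subseteq> kernel (G\<lparr>carrier := ?L\<rparr>) integer_group (\<phi> \<circ> q)"
      "finitely_generated (G\<lparr>carrier := A\<rparr>)"
    let ?A = "G\<lparr>carrier := A\<rparr>" and ?B = "Q\<lparr>carrier := q ` A\<rparr>"
    have B: "subgroup (q ` A) Q" using subgroup_img_is_subgroup[OF A(1)] .
    show "kernel_cascading ?A"
    proof (rule step.IH[OF B])
      show "q ` A \<subseteq> kernel (Q\<lparr>carrier := H\<rparr>) integer_group \<phi>" using A(2) by (auto simp: kernel_def)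
      show "finitely_generated ?B" using finitely_generated_image[OF A(1,3)] .
      show "group_hom ?A ?B q" using group_hom_restrict[OF step.prems(1) A(1) B] by blast
      \<comment> \<open>The kernel of the restriction of \<open>q\<close> to \<open>A\<close> lies
        in \<open>kernel G Q q\<close>, so the local hypothesis is inherited.\<close>
      show "locally_kernel_cascading ?A (kernel ?A ?B q)"
        unfolding locally_kernel_cascading_def
      proof (intro allI impI)
        fix D assume D: "subgroup D ?A" "D \<subseteq> kernel ?A ?B q" "finitely_generated (?A\<lparr>carrier := D\<rparr>)"
        have "D \<subseteq> kernel G Q q" using D(2) subgroup.subset[OF A(1)] by (auto simp: kernel_def)
        then show "kernel_cascading (?A\<lparr>carrier := D\<rparr>)"
          using step.prems(4) G.incl_subgroup[OF A(1) D(1)] D(3)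
          unfolding locally_kernel_cascading_def by simp
      qed
    qed (use A(3) in simp_all)
  qed
qed

text \<open>The previous lemma is applied to each finitely generated \<open>A\<close> over its
  image. Allowing a subset \<open>B\<close> lets the abelian case treat one generated subgroup at a
  time.\<close>

lemma locally_kernel_cascading_extension:
  assumes "group_hom G Q q" and "locally_kernel_cascading Q (q ` B)"
    and "locally_kernel_cascading G (kernel G Q q)"
  shows "locally_kernel_cascading G B"
  unfolding locally_kernel_cascading_def
proof (intro allI impI)
  interpret group_hom G Q q by fact
  fix A assume A: "subgroup A G" "A \<subseteq> B" "finitely_generated (G\<lparr>carrier := A\<rparr>)"
  let ?A = "G\<lparr>carrier := A\<rparr>" and ?B = "Q\<lparr>carrier := q ` A\<rparr>"
  have B: "subgroup (q ` A) Q" using subgroup_img_is_subgroup[OF A(1)] .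
  show "kernel_cascading ?A"
  proof (rule kernel_cascading_extension)
    show "kernel_cascading ?B"
      using assms(2) B A(2) finitely_generated_image[OF A(1,3)]
      unfolding locally_kernel_cascading_def by blast
    show "group_hom ?A ?B q" using group_hom_restrict[OF assms(1) A(1) B] by blast
    show "locally_kernel_cascading ?A (kernel ?A ?B q)"
      unfolding locally_kernel_cascading_def
    proof (intro allI impI)
      fix D assume D: "subgroup D ?A" "D \<subseteq> kernel ?A ?B q" "finitely_generated (?A\<lparr>carrier := D\<rparr>)"
      have "D \<subseteq> kernel G Q q" using D(2) subgroup.subset[OF A(1)] by (auto simp: kernel_def)
      then show "kernel_cascading (?A\<lparr>carrier := D\<rparr>)"
        using assms(3) G.incl_subgroup[OF A(1) D(1)] D(3)
        unfolding locally_kernel_cascading_def by simp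
    qed
  qed (use A(3) in simp_all)
qed

lemma locally_kernel_cascading_mono:
  assumes "locally_kernel_cascading G N" and "M \<subseteq> N"
  shows "locally_kernel_cascading G M"
  using assms unfolding locally_kernel_cascading_def by (meson subset_trans)

lemma locally_kernel_cascading_finite:
  assumes "group G" and "finite N"
  shows "locally_kernel_cascading G N"
  unfolding locally_kernel_cascading_def
  using assms finite_subset subgroup.subgroup_is_group[OF _ assms(1)]
  by (auto intro!: kernel_cascading.finite)

lemma locally_kernel_cascading_of_subgroup:
  assumes "group G" and "subgroup H G"
    and "locally_kernel_cascading (G\<lparr>carrier := H\<rparr>) N" and "N \<subseteq> H"
  shows "locally_kernel_cascading G N"
  unfolding locally_kernel_cascading_def
proof (intro allI impI)
  fix A assume A: "subgroup A G" "A \<subseteq> N" "finitely_generated (G\<lparr>carrier := A\<rparr>)"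
  have "subgroup A (G\<lparr>carrier := H\<rparr>)" using group.subgroup_incl[OF assms(1) A(1) assms(2)] A(2) assms(4) by blast
  then show "kernel_cascading (G\<lparr>carrier := A\<rparr>)"
    using assms(3) A unfolding locally_kernel_cascading_def by simp
qed


section \<open>Abelian groups\<close>

text \<open>A generator is the least positive power of \<open>x\<close> in \<open>B\<close>, or the
  identity if there is none.\<close>

lemma (in group) subgroup_of_cyclic:
  assumes x: "x \<in> carrier G" and B: "subgroup B G" "B \<subseteq> generate G {x}"
  obtains y where "y \<in> B" "B = range (\<lambda>k::int. y [^] k)"
proof (cases "\<exists>n>0::nat. x [^] n \<in> B")
  case False
  have "b = \<one>" if b: "b \<in> B" for b
  proof -
    obtain k :: int where k: "b = x [^] k" using b B(2) generate_pow[OF x] by auto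
    have "x [^] (- k) \<in> B" using subgroup.m_inv_closed[OF B(1) b] unfolding k int_pow_neg[OF x] .
    moreover have "\<bar>k\<bar> = k \<or> \<bar>k\<bar> = - k" by linarith
    ultimately have "x [^] \<bar>k\<bar> \<in> B" using b unfolding k by metis
    then have pow: "x [^] nat \<bar>k\<bar> \<in> B" using int_pow_int[of G x "nat \<bar>k\<bar>"] by simp
    have "k = 0"
    proof (rule ccontr)
      assume "k \<noteq> 0"
      then have "nat \<bar>k\<bar> > 0" by simp
      then have "\<exists>n>0::nat. x [^] n \<in> B" using pow by (intro exI conjI)
      then show False using False by contradiction
    qed
    then show "b = \<one>" using k by simp
  qed
  then have "B = {\<one>}" using subgroup.one_closed[OF B(1)] by blast
  then show ?thesis using that[of \<one>] by auto
next
  case True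
  define d where "d = (LEAST n::nat. n > 0 \<and> x [^] n \<in> B)"
  have d: "d > 0" "x [^] d \<in> B" using LeastI_ex[OF True] by (auto simp: d_def)
  have y: "x [^] d \<in> carrier G" using x by simp
  have pow: "(x [^] d) [^] k = x [^] (int d * k)" for k :: int
    using x by (metis int_pow_pow int_pow_int)
  have yB: "(x [^] d) [^] k \<in> B" for k :: int using d(2) B(1) subgroup_int_pow_closed by blast
  show ?thesis
  proof (rule that[OF d(2)], rule equalityI)
    show "B \<subseteq> range (\<lambda>k::int. (x [^] d) [^] k)"
    proof
      fix b assume b: "b \<in> B"
      obtain k :: int where k: "b = x [^] k" using b B(2) generate_pow[OF x] by auto
      \<comment> \<open>Division with remainder: the remainder power also lies in \<open>B\<close>,
        so minimality of \<open>d\<close> forces the remainder to be 0.\<close>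
      let ?m = "k mod int d"
      have "x [^] ?m = x [^] k \<otimes> inv ((x [^] d) [^] (k div int d))"
        unfolding pow using x by (simp add: minus_mult_div_eq_mod flip: int_pow_diff)
      then have "x [^] ?m \<in> B" using b k yB subgroup.m_closed[OF B(1)] subgroup.m_inv_closed[OF B(1)] by simp
      then have "x [^] nat ?m \<in> B" using int_pow_int[of G x "nat ?m"] d(1) by simp
      moreover have "nat ?m < d" using d(1) by (simp add: nat_less_iff)
      ultimately have "\<not> nat ?m > 0" unfolding d_def by (metis (mono_tags, lifting) not_less_Least)
      then have "nat ?m = 0" by simp
      then have "?m = 0" using d(1) by (smt (verit) nat_0_iff pos_mod_sign of_nat_0_less_iff)
      then have "k = int d * (k div int d)" by auto
      then show "b \<in> range (\<lambda>k::int. (x [^] d) [^] k)" using k pow by (metis rangeI)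
    qed
  qed (use yB in auto)
qed

text \<open>A subgroup of a cyclic group is finite or infinite cyclic. In the second case an
  isomorphism to the integers is itself the required epimorphism; its kernel is trivial, so the
  cascade stops after one step.\<close>

lemma locally_kernel_cascading_cyclic:
  assumes "group Q" and x: "x \<in> carrier Q"
  shows "locally_kernel_cascading Q (generate Q {x})"
  unfolding locally_kernel_cascading_def
proof (intro allI impI)
  interpret group Q by fact
  fix B assume B: "subgroup B Q" "B \<subseteq> generate Q {x}"
  let ?B = "Q\<lparr>carrier := B\<rparr>"
  have gB: "group ?B" using B(1) subgroup.subgroup_is_group group_axioms by blast
  interpret B: group ?B by fact
  show "kernel_cascading ?B"
  proof (cases "finite B")
    case True
    then show ?thesis by (intro kernel_cascading.finite gB) simp
  next
    case False
    obtain y where y: "y \<in> B" "B = range (\<lambda>k::int. y [^]\<^bsub>Q\<^esub> k)"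
      using subgroup_of_cyclic[OF x B] .
    have yQ: "y \<in> carrier Q" using y(1) subgroup.subset[OF B(1)] by blast
    have "inj (\<lambda>k::int. y [^]\<^bsub>Q\<^esub> k)"
      using False infinite_cyclic_subgroup_int[OF yQ] y(2)
      unfolding carrier_subgroup_generated_by_singleton[OF yQ] by (auto intro: injI)
    then have iso: "(\<lambda>k::int. y [^]\<^bsub>Q\<^esub> k) \<in> iso integer_group ?B"
      using y(2) yQ by (auto simp: iso_def hom_def bij_betw_def int_pow_mult)
    \<comment> \<open>The logarithm to base \<open>y\<close>.\<close>
    define \<phi> where "\<phi> = inv_into UNIV (\<lambda>k::int. y [^]\<^bsub>Q\<^esub> k)"
    have \<phi>: "\<phi> \<in> iso ?B integer_group"
      unfolding \<phi>_def using group.iso_set_sym[OF group_integer_group iso] by simp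
    then have ker: "kernel ?B integer_group \<phi> = {\<one>\<^bsub>?B\<^esub>}"
      using group_hom.inj_iff_trivial_ker[of ?B integer_group \<phi>]
      by (simp add: group_hom_def group_hom_axioms_def gB iso_iff)
    show ?thesis
    proof (rule kernel_cascading.step[OF gB B.subgroup_self])
      have "rcosets\<^bsub>?B\<^esub> (carrier ?B) = {carrier ?B}"
        using B.coset_join2[OF _ B.subgroup_self] B.one_closed by (auto simp: RCOSETS_def)
      then show "finite (rcosets\<^bsub>?B\<^esub> (carrier ?B))" by simp
      show "\<phi> \<in> epi (?B\<lparr>carrier := carrier ?B\<rparr>) integer_group"
        using \<phi> by (simp add: iso_iff_mon_epi)
      fix A assume A: "subgroup A ?B"
        "A \<subseteq> kernel (?B\<lparr>carrier := carrier ?B\<rparr>) integer_group \<phi>"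
      have "finite A" using A(2) ker by (auto intro: finite_subset)
      then show "kernel_cascading (?B\<lparr>carrier := A\<rparr>)"
        by (intro kernel_cascading.finite subgroup.subgroup_is_group[OF A(1) gB]) simp
    qed
  qed
qed

text \<open>Induction on a finite generating set: modulo the subgroup generated by \<open>S\<close>,
  the one generated by \<open>insert x S\<close> becomes cyclic.\<close>

lemma locally_kernel_cascading_comm_group:
  assumes "comm_group G"
  shows "locally_kernel_cascading G (carrier G)"
proof -
  interpret comm_group G by fact
  have gen: "locally_kernel_cascading G (generate G S)" if "finite S" "S \<subseteq> carrier G" for S
    using that
  proof (induction S)
    case empty
    show ?case using locally_kernel_cascading_finite[OF is_group] generate_empty by simp
  next
    case (insert x S)
    let ?N = "generate G S"
    let ?q = "\<lambda>g. ?N #>\<^bsub>G\<^esub> g"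
    interpret N: normal ?N G
      using generate_is_subgroup insert.prems by (simp add: subgroup_imp_normal)
    have hom: "group_hom G (G Mod ?N) ?q"
      using N.r_coset_hom_Mod N.factorgroup_is_group by (simp add: group_hom_def group_hom_axioms_def)
    interpret q: group_hom G "G Mod ?N" ?q by fact
    have q_eq: "?q g = \<one>\<^bsub>G Mod ?N\<^esub>" if "g \<in> ?N" for g
      using that N.subset coset_join2[OF _ N.subgroup_axioms] by auto
    have ker: "kernel G (G Mod ?N) ?q = ?N"
      using q_eq N.subset coset_join1[OF _ _ N.subgroup_axioms] by (auto simp: kernel_def)
    have xG: "?q x \<in> carrier (G Mod ?N)" using insert.prems by simp
    have "?q ` generate G (insert x S) = generate (G Mod ?N) (?q ` insert x S)"
      using q.generate_img insert.prems by metis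
    also have "\<dots> \<subseteq> generate (G Mod ?N) {?q x}"
    proof (rule q.H.generate_subgroup_incl)
      show "?q ` insert x S \<subseteq> generate (G Mod ?N) {?q x}"
        using q_eq generate.incl[of _ S G] generate.one[of "G Mod ?N"] by (auto intro: generate.incl)
      show "subgroup (generate (G Mod ?N) {?q x}) (G Mod ?N)"
        using q.H.generate_is_subgroup xG by simp
    qed
    finally have "locally_kernel_cascading (G Mod ?N) (?q ` generate G (insert x S))"
      by (rule locally_kernel_cascading_mono[OF locally_kernel_cascading_cyclic[OF q.H.is_group xG]])
    then show ?case using locally_kernel_cascading_extension[OF hom] insert ker by simp
  qed
  show ?thesis unfolding locally_kernel_cascading_def
  proof (intro allI impI)
    fix A assume A: "subgroup A G" "finitely_generated (G\<lparr>carrier := A\<rparr>)"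
    obtain S where S: "S \<subseteq> A" "finite S" "generate G S = A"
      using finitely_generated_subgroup_iff[OF A(1)] A(2) by blast
    then show "kernel_cascading (G\<lparr>carrier := A\<rparr>)"
      using gen[OF S(2)] A subgroup.subset[OF A(1)] unfolding locally_kernel_cascading_def by blast
  qed
qed


section \<open>Elementary amenable groups\<close>

lemma directed_finite_subset:
  assumes "finite S" and "S \<subseteq> \<Union>\<F>" and "\<F> \<noteq> {}"
    and "\<And>H K. H \<in> \<F> \<Longrightarrow> K \<in> \<F> \<Longrightarrow> \<exists>L \<in> \<F>. H \<subseteq> L \<and> K \<subseteq> L"
  shows "\<exists>L \<in> \<F>. S \<subseteq> L"
  using assms(1,2)
proof induction
  case empty
  then show ?case using assms(3) by blast
next
  case (insert x S)
  then obtain L K where "L \<in> \<F>" "S \<subseteq> L" "K \<in> \<F>" "x \<in> K" by auto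
  then show ?case using assms(4)[of L K] by blast
qed

text \<open>The conjunct \<open>group G\<close> is carried along because in the isomorphism and
  extension clauses it is the induction hypothesis that makes the target of the homomorphism a
  group. An isomorphism is treated as an extension with trivial kernel.\<close>

lemma elementary_amenable_locally_kernel_cascading:
  assumes "elementary_amenable G"
  shows "group G \<and> locally_kernel_cascading G (carrier G)"
  using assms
proof (induction rule: elementary_amenable.induct)
  case (finite G)
  then show ?case using locally_kernel_cascading_finite by blast
next
  case (abelian G)
  then show ?case using locally_kernel_cascading_comm_group comm_group.axioms(2) by blast
next
  case (isomorphism G H)
  then obtain f where f: "f \<in> iso H G" using group.iso_sym unfolding is_iso_def by blast
  then have hom: "group_hom H G f" using isomorphism
    by (simp add: group_hom_def group_hom_axioms_def iso_iff)
  have "kernel H G f = {\<one>\<^bsub>H\<^esub>}" using f group_hom.inj_iff_trivial_ker[OF hom] by (simp add: iso_iff)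
  then have "locally_kernel_cascading H (kernel H G f)"
    using locally_kernel_cascading_finite[OF isomorphism(2)] by simp
  moreover have "f ` carrier H = carrier G" using f by (simp add: iso_iff)
  ultimately show ?case using locally_kernel_cascading_extension[OF hom] isomorphism by simp
next
  case (extension G q Q)
  then have hom: "group_hom G Q q" by (simp add: group_hom_def group_hom_axioms_def epi_def)
  have "locally_kernel_cascading G (kernel G Q q)"
    using locally_kernel_cascading_of_subgroup[OF extension(1) group_hom.subgroup_kernel[OF hom]] extension
    by simp
  moreover have "q ` carrier G = carrier Q" using extension(2) by (simp add: epi_def)
  ultimately show ?case using locally_kernel_cascading_extension[OF hom] extension by simp
next
  case (directed_union G \<F>)
  interpret group G by fact
  have "locally_kernel_cascading G (carrier G)" unfolding locally_kernel_cascading_def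
  proof (intro allI impI)
    fix A assume A: "subgroup A G" "finitely_generated (G\<lparr>carrier := A\<rparr>)"
    obtain S where S: "S \<subseteq> A" "finite S" "generate G S = A"
      using finitely_generated_subgroup_iff[OF A(1)] A(2) by blast
    have "S \<subseteq> \<Union>\<F>" using S(1) subgroup.subset[OF A(1)] directed_union by blast
    \<comment> \<open>Directedness puts the finitely many generators, hence all of \<open>A\<close>,
      into a single member of the family.\<close>
    then obtain L where L: "L \<in> \<F>" "S \<subseteq> L"
      using directed_finite_subset[OF S(2) _ directed_union(2)] directed_union by blast
    have sL: "subgroup L G" using directed_union L(1) by blast
    have "A \<subseteq> L" using generate_subgroup_incl[OF L(2) sL] S(3) by simp
    moreover have "locally_kernel_cascading G L"
      using locally_kernel_cascading_of_subgroup[OF is_group sL] directed_union L(1) by fastforce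
    ultimately show "kernel_cascading (G\<lparr>carrier := A\<rparr>)"
      using A unfolding locally_kernel_cascading_def by blast
  qed
  then show ?case using directed_union by blast
qed

theorem corollary3p8:
  fixes G :: "'a monoid"
  assumes "group G"
    and "finitely_generated G"
    and "elementary_amenable G"
  shows "cascading G"
proof -
  have "locally_kernel_cascading G (carrier G)"
    using elementary_amenable_locally_kernel_cascading[OF assms(3)] by blast
  then have "kernel_cascading G"
    using group.subgroup_self[OF assms(1)] assms(2) unfolding locally_kernel_cascading_def by fastforce
  then show ?thesis by (rule kernel_cascading_imp_cascading)
qed

end
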